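(* Let $X$ be a non-empty metric space. Then for all $0<\theta<1$, $$\underline{\dim}^{\theta}_{\mathrm{L}}X=\inf_{0<\lambda\leq\theta}\dim^{\lambda}_{\mathrm{L}}X.$$
   Context: For a metric space $X$, $B(x,r)$ denotes the closed ball in $X$ with centre $x$ and radius $r$, and $N_r(E)\in\mathbb{N}\cup\{\infty\}$ denotes the least number of closed balls of radius $r$ required to cover $E\subset X$. For $0<\theta<1$ define (with values in $[0,\infty]$) the lower spectrum $$\dim^{\theta}_{\mathrm{L}}X=\sup\Bigl\{s\geq0:\exists C>0\ \forall\,0<r<1,\ \inf_{x\in X}N_r(B(x,r^\theta))\geq C\Bigl(\frac{r^\theta}{r}\Bigr)^s\Bigr\}$$ and the monotone lower spectrum $$\underline{\dim}^{\theta}_{\mathrm{L}}X=\sup\Bigl\{s\geq0:\exists C>0\ \forall\,0<r\leq r^\theta\leq R<1,\ \inf_{x\in X}N_r(B(x,R))\geq C\Bigl(\frac{R}{r}\Bigr)^s\Bigr\}.$$ *)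

theory Defs
  imports "HOL-Analysis.Analysis"
begin

context Metric_space
begin

text \<open>
  Least number of closed balls of radius \<open>r\<close> needed to cover \<open>E\<close>. The centres may be any
  points of the space; the value is \<open>\<infinity>\<close> (the infimum of the empty set) if no finite cover exists.
\<close>
definition covering_number :: "real \<Rightarrow> 'a set \<Rightarrow> enat" where
  "covering_number r E =
     Inf {enat (card F) | F. finite F \<and> F \<subseteq> M \<and> E \<subseteq> (\<Union>y\<in>F. mcball y r)}"

definition lower_spectrum :: "real \<Rightarrow> ennreal" where
  "lower_spectrum \<theta> =
     Sup {ennreal s | s. s \<ge> 0 \<and>
       (\<exists>C>0. \<forall>r. 0 < r \<and> r < 1 \<longrightarrow>
          ennreal_of_enat (INF x\<in>M. covering_number r (mcball x (r powr \<theta>)))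
            \<ge> ennreal (C * (r powr \<theta> / r) powr s))}"

definition monotone_lower_spectrum :: "real \<Rightarrow> ennreal" where
  "monotone_lower_spectrum \<theta> =
     Sup {ennreal s | s. s \<ge> 0 \<and>
       (\<exists>C>0. \<forall>r R. 0 < r \<and> r \<le> r powr \<theta> \<and> r powr \<theta> \<le> R \<and> R < 1 \<longrightarrow>
          ennreal_of_enat (INF x\<in>M. covering_number r (mcball x R))
            \<ge> ennreal (C * (R / r) powr s))}"

end

end

theory Submission
  imports Defs
begin

text \<open>
  Write \<open>R = r\<^sup>\<kappa>\<close> with \<open>0 < \<kappa> \<le> \<theta>\<close>. The monotone spectrum at \<open>\<theta>\<close> asks for a bound that is uniform
  over all such \<open>\<kappa>\<close>, whereas each \<open>lower_spectrum \<kappa>\<close> comes with a constant of its own; hence the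
  inequality \<open>\<le>\<close> is a specialisation, and the content of \<open>\<ge>\<close> is that the constants can be made
  uniform.

  The reason is that \<open>N\<^sub>r(B(x,R))\<close> increases with \<open>R\<close>. For \<open>\<kappa> \<le> \<mu>\<close> and \<open>r < 1\<close> the ball of radius
  \<open>r\<^sup>\<kappa>\<close> contains the ball of radius \<open>r\<^sup>\<mu>\<close>, so a bound with exponent \<open>t\<close> at \<open>\<mu>\<close> gives
  \<open>N\<^sub>r(B(x,r\<^sup>\<kappa>)) \<ge> C (r\<^sup>\<mu> / r)\<^sup>t\<close>. If \<open>s < t\<close>, this beats \<open>C (r\<^sup>\<kappa> / r)\<^sup>s\<close> as soon as
  \<open>(1 - \<kappa>) s \<le> (1 - \<mu>) t\<close>, that is, for all \<open>\<kappa>\<close> slightly to the left of \<open>\<mu>\<close> (lemma \<open>bound_left_of\<close>); and because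
  \<open>1 - \<mu> \<ge> 1 - \<theta> > 0\<close>, how far to the left does not depend on \<open>\<mu>\<close>.
  Finitely many equally spaced \<open>\<mu>\<close> therefore serve the whole interval \<open>(0, \<theta>]\<close>, including its
  open end at \<open>0\<close>, and the least of their constants is uniform (lemma \<open>uniform_bound\<close>).
  Giving up an arbitrarily small part of the exponent does not change the supremum.
\<close>

context Metric_space
begin

definition least_ball_cover :: "real \<Rightarrow> real \<Rightarrow> ennreal" where
  "least_ball_cover r R = ennreal_of_enat (INF x\<in>M. covering_number r (mcball x R))"

lemma covering_number_mono:
  assumes "E \<subseteq> E'"
  shows "covering_number r E \<le> covering_number r E'"
  unfolding covering_number_def by (rule Inf_superset_mono) (use assms in blast)

lemma least_ball_cover_mono:
  assumes "R \<le> R'"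
  shows "least_ball_cover r R \<le> least_ball_cover r R'"
  unfolding least_ball_cover_def
  by (intro ennreal_of_enat_le_iff[THEN iffD2] INF_mono')
     (use assms mcball_subset_concentric covering_number_mono in blast)

text \<open>
  The admissible exponents form a down-set because \<open>r\<^sup>\<phi> / r \<ge> 1\<close>; this is where \<open>\<phi> \<le> 1\<close> enters.
\<close>
lemma less_lower_spectrumE:
  assumes "ennreal s < lower_spectrum \<phi>" "0 \<le> s" "\<phi> \<le> 1"
  obtains C where "C > 0"
    "\<And>r. \<lbrakk>0 < r; r < 1\<rbrakk> \<Longrightarrow> ennreal (C * (r powr \<phi> / r) powr s) \<le> least_ball_cover r (r powr \<phi>)"
proof -
  from assms(1) obtain t C where t: "ennreal s < ennreal t" "t \<ge> 0" and C: "C > 0"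
    and bd: "\<And>r. \<lbrakk>0 < r; r < 1\<rbrakk> \<Longrightarrow>
               ennreal (C * (r powr \<phi> / r) powr t) \<le> least_ball_cover r (r powr \<phi>)"
    unfolding lower_spectrum_def less_Sup_iff least_ball_cover_def by blast
  have "s \<le> t"
    using t assms(2) by (simp add: ennreal_less_iff)
  show thesis
  proof (rule that[OF C])
    fix r :: real
    assume r: "0 < r" "r < 1"
    have "r powr 1 \<le> r powr \<phi>"
      using r assms(3) by (intro powr_mono') auto
    hence "(r powr \<phi> / r) powr s \<le> (r powr \<phi> / r) powr t"
      using r \<open>s \<le> t\<close> by (intro powr_mono) auto
    hence "ennreal (C * (r powr \<phi> / r) powr s) \<le> ennreal (C * (r powr \<phi> / r) powr t)"
      using C by (intro ennreal_leI mult_left_mono) auto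
    with bd[OF r] show "ennreal (C * (r powr \<phi> / r) powr s) \<le> least_ball_cover r (r powr \<phi>)"
      by simp
  qed
qed

text \<open>
  Moving from \<open>\<mu>\<close> to a smaller \<open>\<kappa>\<close> enlarges the ball, which can only increase the covering
  number, and the surplus \<open>t - s\<close> in the exponent pays for the larger ratio \<open>r\<^sup>\<kappa> / r\<close>.
\<close>
lemma bound_left_of:
  assumes bd: "ennreal (C * (r powr \<mu> / r) powr t) \<le> least_ball_cover r (r powr \<mu>)"
    and r: "0 < r" "r < 1" and C: "0 \<le> C"
    and le: "\<kappa> \<le> \<mu>" "(1 - \<kappa>) * s \<le> (1 - \<mu>) * t"
  shows "ennreal (C * (r powr \<kappa> / r) powr s) \<le> least_ball_cover r (r powr \<kappa>)"
proof -
  have ratio: "(r powr a / r) powr b = r powr ((a - 1) * b)" for a b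
    using r powr_diff[of r a 1] powr_powr[of r "a - 1" b] by simp
  have "(r powr \<kappa> / r) powr s \<le> (r powr \<mu> / r) powr t"
    unfolding ratio using r le(2) by (intro powr_mono') (auto simp: algebra_simps)
  hence "ennreal (C * (r powr \<kappa> / r) powr s) \<le> ennreal (C * (r powr \<mu> / r) powr t)"
    using C by (intro ennreal_leI mult_left_mono) auto
  also note bd
  also have "least_ball_cover r (r powr \<mu>) \<le> least_ball_cover r (r powr \<kappa>)"
    using r le(1) by (intro least_ball_cover_mono powr_mono') auto
  finally show ?thesis .
qed

text \<open>
  The compactness step: the grid points \<open>\<theta> k / n\<close>, \<open>1 \<le> k \<le> n\<close>, are so dense that every
  \<open>\<kappa> \<in> (0, \<theta>]\<close> lies within the range of \<open>bound_left_of\<close> for the next grid point above it.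
\<close>
lemma uniform_bound:
  assumes \<theta>: "0 < \<theta>" "\<theta> < 1" and s: "0 \<le> s" "s < t"
    and t: "\<And>\<phi>. \<lbrakk>0 < \<phi>; \<phi> \<le> \<theta>\<rbrakk> \<Longrightarrow> ennreal t < lower_spectrum \<phi>"
  obtains C where "C > 0"
    "\<And>r \<kappa>. \<lbrakk>0 < r; r < 1; 0 < \<kappa>; \<kappa> \<le> \<theta>\<rbrakk> \<Longrightarrow>
       ennreal (C * (r powr \<kappa> / r) powr s) \<le> least_ball_cover r (r powr \<kappa>)"
proof -
  have "\<exists>C>0. \<forall>r. 0 < r \<and> r < 1 \<longrightarrow>
          ennreal (C * (r powr \<phi> / r) powr t) \<le> least_ball_cover r (r powr \<phi>)"
    if "0 < \<phi>" "\<phi> \<le> \<theta>" for \<phi>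
    using less_lower_spectrumE[OF t[OF that]] that \<theta> s by (metis less_eq_real_def order_trans)
  then obtain c where c: "\<And>\<phi>. \<lbrakk>0 < \<phi>; \<phi> \<le> \<theta>\<rbrakk> \<Longrightarrow> c \<phi> > 0"
    and bd: "\<And>\<phi> r. \<lbrakk>0 < \<phi>; \<phi> \<le> \<theta>; 0 < r; r < 1\<rbrakk> \<Longrightarrow>
               ennreal (c \<phi> * (r powr \<phi> / r) powr t) \<le> least_ball_cover r (r powr \<phi>)"
    by metis
  have gap: "0 < (t - s) * (1 - \<theta>)"
    using s \<theta> by simp
  \<comment> \<open>The spacing \<open>\<theta> / n\<close> must cost less, at rate \<open>s\<close>, than the surplus at the worst \<open>\<mu> = \<theta>\<close>.\<close>
  obtain n :: nat where n: "s * \<theta> / ((t - s) * (1 - \<theta>)) < real n"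
    using reals_Archimedean2 by blast
  hence "n > 0"
    using s \<theta> gap by (cases n) (auto simp: divide_less_0_iff mult_less_0_iff)
  with n gap have step: "s * (\<theta> / n) \<le> (t - s) * (1 - \<theta>)"
    by (simp add: field_simps)
  define grid where "grid k = \<theta> * real k / real n" for k
  have grid: "0 < grid k" "grid k \<le> \<theta>" if "k \<in> {1..n}" for k
    using that \<theta> by (auto simp: grid_def field_simps)
  define C where "C = Min ((\<lambda>k. c (grid k)) ` {1..n})"
  have "C > 0"
    unfolding C_def using \<open>n > 0\<close> grid c by (subst Min_gr_iff) auto
  show thesis
  proof (rule that[OF \<open>C > 0\<close>])
    fix r \<kappa> :: real
    assume r: "0 < r" "r < 1" and \<kappa>: "0 < \<kappa>" "\<kappa> \<le> \<theta>"
    define k where "k = nat \<lceil>\<kappa> * n / \<theta>\<rceil>"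
    have pos: "0 < \<kappa> * n / \<theta>"
      using \<kappa> \<theta> \<open>n > 0\<close> by simp
    have k_real: "\<kappa> * n / \<theta> \<le> real k" "real k < \<kappa> * n / \<theta> + 1"
      using pos unfolding k_def by linarith+
    have "\<kappa> * n / \<theta> \<le> real n"
      using \<kappa> \<theta> by (simp add: field_simps mult_right_mono)
    with k_real pos have k: "k \<in> {1..n}"
      unfolding k_def by (auto simp: ceiling_le_iff nat_le_iff) linarith
    have "\<kappa> * n \<le> \<theta> * k" "\<theta> * k \<le> \<theta> + \<kappa> * n"
      using k_real \<theta> by (auto simp: field_simps)
    hence "\<kappa> * n / n \<le> \<theta> * k / n" "\<theta> * k / n \<le> (\<theta> + \<kappa> * n) / n"
      by (intro divide_right_mono; simp)+
    hence near: "\<kappa> \<le> grid k" "grid k - \<kappa> \<le> \<theta> / n"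
      using \<open>n > 0\<close> by (auto simp: grid_def add_divide_distrib)
    have "s * (grid k - \<kappa>) \<le> s * (\<theta> / n)"
      using near s by (intro mult_left_mono)
    also have "\<dots> \<le> (t - s) * (1 - \<theta>)"
      by (fact step)
    also have "\<dots> \<le> (t - s) * (1 - grid k)"
      using s grid[OF k] by (intro mult_left_mono) auto
    finally have exponents: "(1 - \<kappa>) * s \<le> (1 - grid k) * t"
      by (simp add: algebra_simps)
    have "C \<le> c (grid k)"
      unfolding C_def using k by (intro Min_le) auto
    hence "ennreal (C * (r powr grid k / r) powr t)
             \<le> ennreal (c (grid k) * (r powr grid k / r) powr t)"
      by (intro ennreal_leI mult_right_mono) auto
    also have "\<dots> \<le> least_ball_cover r (r powr grid k)"
      using bd grid[OF k] r by blast
    finally show "ennreal (C * (r powr \<kappa> / r) powr s) \<le> least_ball_cover r (r powr \<kappa>)"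
      by (rule bound_left_of) (use r near exponents \<open>C > 0\<close> in auto)
  qed
qed

lemma monotone_lower_spectrum_le:
  assumes "0 < \<phi>" "\<phi> \<le> \<theta>" "\<theta> < 1"
  shows "monotone_lower_spectrum \<theta> \<le> lower_spectrum \<phi>"
  unfolding monotone_lower_spectrum_def lower_spectrum_def
proof (rule Sup_subset_mono, safe)
  fix s C :: real
  assume s: "0 \<le> s" and C: "0 < C"
    and bd: "\<forall>r R. 0 < r \<and> r \<le> r powr \<theta> \<and> r powr \<theta> \<le> R \<and> R < 1 \<longrightarrow>
      ennreal (C * (R / r) powr s) \<le> ennreal_of_enat (INF x\<in>M. covering_number r (mcball x R))"
  have "r \<le> r powr \<theta>" "r powr \<theta> \<le> r powr \<phi>" "r powr \<phi> < 1" if "0 < r" "r < 1" for r :: real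
    using that assms powr_mono'[of \<theta> 1 r] powr_mono'[of \<phi> \<theta> r] powr_less_mono'[of r 0 \<phi>]
    by auto
  with bd s C show "\<exists>s'. ennreal s = ennreal s' \<and> 0 \<le> s' \<and> (\<exists>C>0. \<forall>r. 0 < r \<and> r < 1 \<longrightarrow>
      ennreal (C * (r powr \<phi> / r) powr s')
        \<le> ennreal_of_enat (INF x\<in>M. covering_number r (mcball x (r powr \<phi>))))"
    by blast
qed

lemma INF_lower_spectrum_le:
  assumes \<theta>: "0 < \<theta>" "\<theta> < 1"
  shows "(INF \<phi>\<in>{0<..\<theta>}. lower_spectrum \<phi>) \<le> monotone_lower_spectrum \<theta>"
proof (rule dense_le)
  fix y
  assume "y < (INF \<phi>\<in>{0<..\<theta>}. lower_spectrum \<phi>)"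
  then obtain z where yz: "y < z" and z: "z < (INF \<phi>\<in>{0<..\<theta>}. lower_spectrum \<phi>)"
    using dense by blast
  have "y < top" "z < top"
    using yz z by (auto intro: less_le_trans order_less_trans)
  then obtain s t where st: "y = ennreal s" "0 \<le> s" "z = ennreal t" "0 \<le> t"
    by (metis ennreal_cases less_irrefl infinity_ennreal_def)
  with yz have "s < t"
    by (simp add: ennreal_less_iff)
  have "ennreal t < lower_spectrum \<phi>" if "0 < \<phi>" "\<phi> \<le> \<theta>" for \<phi>
    using less_INF_D[OF z] st that by simp
  then obtain C where C: "C > 0"
    and bd: "\<And>r \<kappa>. \<lbrakk>0 < r; r < 1; 0 < \<kappa>; \<kappa> \<le> \<theta>\<rbrakk> \<Longrightarrow>
       ennreal (C * (r powr \<kappa> / r) powr s) \<le> least_ball_cover r (r powr \<kappa>)"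
    using uniform_bound[OF \<theta> \<open>0 \<le> s\<close> \<open>s < t\<close>] by blast
  have "ennreal (C * (R / r) powr s) \<le> least_ball_cover r R"
    if r: "0 < r" "r \<le> r powr \<theta>" "r powr \<theta> \<le> R" "R < 1" for r R
  proof -
    have "r < 1" "0 < R"
      using r by (auto intro: less_le_trans)
    define \<kappa> where "\<kappa> = log r R"
    have R: "r powr \<kappa> = R"
      using r \<open>r < 1\<close> \<open>0 < R\<close> by (simp add: \<kappa>_def)
    have "0 < \<kappa>"
      using r \<open>r < 1\<close> \<open>0 < R\<close> by (simp add: \<kappa>_def log_def divide_neg_neg)
    moreover have "\<kappa> \<le> \<theta>"
      using powr_less_mono'[of r \<theta> \<kappa>] R r \<open>r < 1\<close> by (auto simp: not_less[symmetric])
    ultimately show ?thesis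
      using bd[of r \<kappa>] R r(1) \<open>r < 1\<close> by simp
  qed
  with C st show "y \<le> monotone_lower_spectrum \<theta>"
    unfolding monotone_lower_spectrum_def least_ball_cover_def by (intro Sup_upper) blast
qed

end

theorem theoremA1:
  fixes X :: "'a set" and d :: "'a \<Rightarrow> 'a \<Rightarrow> real" and \<theta> :: real
  assumes "Metric_space X d" and "X \<noteq> {}"
    and "0 < \<theta>" and "\<theta> < 1"
  shows "Metric_space.monotone_lower_spectrum X d \<theta> =
           (INF \<phi>\<in>{0<..\<theta>}. Metric_space.lower_spectrum X d \<phi>)"
proof (rule antisym)
  interpret Metric_space X d
    by (fact assms(1))
  show "monotone_lower_spectrum \<theta> \<le> (INF \<phi>\<in>{0<..\<theta>}. lower_spectrum \<phi>)"
    using assms(4) by (intro INF_greatest monotone_lower_spectrum_le) auto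
  show "(INF \<phi>\<in>{0<..\<theta>}. lower_spectrum \<phi>) \<le> monotone_lower_spectrum \<theta>"
    using assms(3,4) by (rule INF_lower_spectrum_le)
qed

end
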